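(* Let $A$ be a commutative ring with identity. There is a bijective correspondence, given by $\alpha\mapsto(\mathrm{supp}(\alpha),<_\alpha)$, between the set of all discrete prime cones $\alpha$ of $A$ and the set of all pairs $(\mathfrak p,<)$ where $\mathfrak p$ is a real prime ideal of $A$ and $<$ is a discrete ordering of $A/\mathfrak p$. As a special case, there is a bijective correspondence between the set of all discrete orderings of $A$ and the set of all discrete prime cones $\alpha$ of $A$ such that $\mathrm{supp}(\alpha)=\{0\}$.
   Context: An ordering $<$ of a ring is discrete if there is no element $a$ with $0<a<1$. $\mathrm{Spec}_r(A)$ is the real spectrum of $A$, i.e. the set of prime cones $\alpha\subseteq A$; $\mathrm{supp}(\alpha)=\alpha\cap-\alpha$ is a real prime ideal, and $<_\alpha$ denotes the ordering of $A/\mathrm{supp}(\alpha)$ induced by $\alpha$ (its non-negative elements are the images of the elements of $\alpha$). A prime cone $\alpha\in\mathrm{Spec}_r(A)$ is a discrete prime cone of $A$ if for every $f\in A$, if $f\in\alpha$ and $f\notin\mathrm{supp}(\alpha)$, then $f-1\in\alpha$. *)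

theory Defs
  imports "HOL-Algebra.QuotRing"
begin

text \<open>
  An ordering of a ring is given by its strict order relation, confined to the carrier so that
  equal orderings are equal as sets of pairs. The zero ring, whose empty relation satisfies all
  the other clauses, is regarded as having no ordering; this matches the requirement
  \<open>-1 \<notin> \<alpha>\<close> on prime cones.
\<close>

definition ring_ordering :: "('a, 'm) ring_scheme \<Rightarrow> ('a \<times> 'a) set \<Rightarrow> bool" where
  "ring_ordering R r \<longleftrightarrow>
     \<one>\<^bsub>R\<^esub> \<noteq> \<zero>\<^bsub>R\<^esub> \<and>
     r \<subseteq> carrier R \<times> carrier R \<and>
     strict_linear_order_on (carrier R) r \<and>
     (\<forall>a b c. (a, b) \<in> r \<longrightarrow> c \<in> carrier R \<longrightarrow> (a \<oplus>\<^bsub>R\<^esub> c, b \<oplus>\<^bsub>R\<^esub> c) \<in> r) \<and>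
     (\<forall>a b. (\<zero>\<^bsub>R\<^esub>, a) \<in> r \<longrightarrow> (\<zero>\<^bsub>R\<^esub>, b) \<in> r \<longrightarrow> (\<zero>\<^bsub>R\<^esub>, a \<otimes>\<^bsub>R\<^esub> b) \<in> r)"

definition discrete_ordering :: "('a, 'm) ring_scheme \<Rightarrow> ('a \<times> 'a) set \<Rightarrow> bool" where
  "discrete_ordering R r \<longleftrightarrow>
     ring_ordering R r \<and>
     \<not> (\<exists>a \<in> carrier R. (\<zero>\<^bsub>R\<^esub>, a) \<in> r \<and> (a, \<one>\<^bsub>R\<^esub>) \<in> r)"

definition real_prime_ideal :: "('a, 'm) ring_scheme \<Rightarrow> 'a set \<Rightarrow> bool" where
  "real_prime_ideal R I \<longleftrightarrow>
     primeideal I R \<and>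
     (\<forall>(n::nat) f. f \<in> {..<n} \<rightarrow> carrier R \<longrightarrow>
        (\<Oplus>\<^bsub>R\<^esub>i\<in>{..<n}. f i \<otimes>\<^bsub>R\<^esub> f i) \<in> I \<longrightarrow> (\<forall>i<n. f i \<in> I))"

text \<open>
  Prime cones in the sense of Bochnak, Coste and Roy. Taking \<open>a = b\<close> in the last clause gives
  \<open>\<alpha> \<union> -\<alpha> = R\<close>.
\<close>

definition prime_cone :: "('a, 'm) ring_scheme \<Rightarrow> 'a set \<Rightarrow> bool" where
  "prime_cone R \<alpha> \<longleftrightarrow>
     \<alpha> \<subseteq> carrier R \<and>
     (\<forall>a\<in>\<alpha>. \<forall>b\<in>\<alpha>. a \<oplus>\<^bsub>R\<^esub> b \<in> \<alpha>) \<and>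
     (\<forall>a\<in>\<alpha>. \<forall>b\<in>\<alpha>. a \<otimes>\<^bsub>R\<^esub> b \<in> \<alpha>) \<and>
     (\<forall>a\<in>carrier R. a \<otimes>\<^bsub>R\<^esub> a \<in> \<alpha>) \<and>
     \<ominus>\<^bsub>R\<^esub> \<one>\<^bsub>R\<^esub> \<notin> \<alpha> \<and>
     (\<forall>a\<in>carrier R. \<forall>b\<in>carrier R. a \<otimes>\<^bsub>R\<^esub> b \<in> \<alpha> \<longrightarrow> a \<in> \<alpha> \<or> \<ominus>\<^bsub>R\<^esub> b \<in> \<alpha>)"

definition real_spectrum :: "('a, 'm) ring_scheme \<Rightarrow> 'a set set" where
  "real_spectrum R = {\<alpha>. prime_cone R \<alpha>}"

definition cone_supp :: "('a, 'm) ring_scheme \<Rightarrow> 'a set \<Rightarrow> 'a set" where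
  "cone_supp R \<alpha> = \<alpha> \<inter> (\<lambda>a. \<ominus>\<^bsub>R\<^esub> a) ` \<alpha>"

text \<open>
  The strict ordering of \<open>R/supp(\<alpha>)\<close> whose non-negative elements are the images of the elements
  of \<open>\<alpha>\<close>.
\<close>

definition cone_less :: "('a, 'm) ring_scheme \<Rightarrow> 'a set \<Rightarrow> ('a set \<times> 'a set) set" where
  "cone_less R \<alpha> =
     (let Q = R Quot (cone_supp R \<alpha>) in
      {(x, y) \<in> carrier Q \<times> carrier Q.
         x \<noteq> y \<and> y \<ominus>\<^bsub>Q\<^esub> x \<in> (\<lambda>a. cone_supp R \<alpha> +>\<^bsub>R\<^esub> a) ` \<alpha>})"

definition discrete_prime_cone :: "('a, 'm) ring_scheme \<Rightarrow> 'a set \<Rightarrow> bool" where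
  "discrete_prime_cone R \<alpha> \<longleftrightarrow>
     \<alpha> \<in> real_spectrum R \<and>
     (\<forall>f\<in>carrier R. f \<in> \<alpha> \<and> f \<notin> cone_supp R \<alpha> \<longrightarrow> f \<ominus>\<^bsub>R\<^esub> \<one>\<^bsub>R\<^esub> \<in> \<alpha>)"

text \<open>
  The pullback of \<open><\<^sub>\<alpha>\<close> along \<open>R \<rightarrow> R/supp(\<alpha>)\<close>. It is an ordering of \<open>R\<close> when
  \<open>supp(\<alpha>) = {0}\<close>, the projection then being the identification of \<open>R\<close> with \<open>R/{0}\<close>.
\<close>

definition cone_less_pullback :: "('a, 'm) ring_scheme \<Rightarrow> 'a set \<Rightarrow> ('a \<times> 'a) set" where
  "cone_less_pullback R \<alpha> =
     {(a, b) \<in> carrier R \<times> carrier R.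
        (cone_supp R \<alpha> +>\<^bsub>R\<^esub> a, cone_supp R \<alpha> +>\<^bsub>R\<^esub> b) \<in> cone_less R \<alpha>}"

end

theory Submission
  imports Defs
begin

text \<open>
  Both correspondences are instances of one fact: for a surjective homomorphism \<open>h : R \<rightarrow> S\<close>,
  the discrete prime cones of \<open>R\<close> whose support is the kernel of \<open>h\<close> correspond to the discrete
  orderings of \<open>S\<close>. The projections \<open>R \<rightarrow> R/p\<close> give the first claim, fibre by fibre over \<open>p\<close>;
  the identity of \<open>R\<close> would give the second, and for zero support the pullback of the order on
  \<open>R/{0}\<close> is indeed the order that the cone defines on \<open>R\<close> itself.

  The fact splits in two. In a single ring, taking the nonnegative elements of an ordering is
  inverse to ordering elements by whether their difference lies in a cone; zero support is
  exactly antisymmetry of the latter relation, and primeness of the cone makes products of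
  positive elements nonzero (\<open>bij_betw_order_of_cone\<close>). Along \<open>h\<close>, a cone is stable under adding
  elements of its support, so if the support is the kernel then \<open>h a\<close> lies in the image of the
  cone only when \<open>a\<close> lies in the cone; all defining clauses therefore pass between a cone and its
  image (\<open>bij_betw_image_cone\<close>).

  It remains that supports are real prime ideals (\<open>cone_supp_real_prime_ideal\<close>), so that
  the fibres over real prime ideals exhaust the discrete prime cones.
\<close>

section \<open>Prime cones and their supports\<close>

lemma prime_coneD:
  assumes "prime_cone R \<alpha>"
  shows prime_cone_subset: "\<alpha> \<subseteq> carrier R"
    and prime_cone_add: "\<And>a b. \<lbrakk>a \<in> \<alpha>; b \<in> \<alpha>\<rbrakk> \<Longrightarrow> a \<oplus>\<^bsub>R\<^esub> b \<in> \<alpha>"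
    and prime_cone_mult: "\<And>a b. \<lbrakk>a \<in> \<alpha>; b \<in> \<alpha>\<rbrakk> \<Longrightarrow> a \<otimes>\<^bsub>R\<^esub> b \<in> \<alpha>"
    and prime_cone_square: "\<And>a. a \<in> carrier R \<Longrightarrow> a \<otimes>\<^bsub>R\<^esub> a \<in> \<alpha>"
    and prime_cone_minus_one: "\<ominus>\<^bsub>R\<^esub> \<one>\<^bsub>R\<^esub> \<notin> \<alpha>"
    and prime_cone_prime:
      "\<And>a b. \<lbrakk>a \<in> carrier R; b \<in> carrier R; a \<otimes>\<^bsub>R\<^esub> b \<in> \<alpha>\<rbrakk> \<Longrightarrow> a \<in> \<alpha> \<or> \<ominus>\<^bsub>R\<^esub> b \<in> \<alpha>"
  using assms unfolding prime_cone_def by auto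

lemma (in ring) diff_eq_zero_iff:
  assumes "a \<in> carrier R" "b \<in> carrier R"
  shows "a \<ominus> b = \<zero> \<longleftrightarrow> a = b"
proof
  assume "a \<ominus> b = \<zero>"
  moreover have "(a \<ominus> b) \<oplus> b = a" using assms by (simp add: minus_eq a_assoc l_neg)
  ultimately show "a = b" using assms by simp
qed (use assms in \<open>simp add: minus_eq r_neg\<close>)

lemma (in ring) neg_eq_zero_iff:
  assumes "a \<in> carrier R"
  shows "\<ominus> a = \<zero> \<longleftrightarrow> a = \<zero>"
  using assms by (metis minus_minus minus_zero)

lemma (in cring) prime_cone_zero:
  assumes "prime_cone R \<alpha>"
  shows "\<zero> \<in> \<alpha>"
  using prime_cone_square[OF assms, of \<zero>] by simp

lemma (in cring) prime_cone_total:
  assumes "prime_cone R \<alpha>" "a \<in> carrier R"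
  shows "a \<in> \<alpha> \<or> \<ominus> a \<in> \<alpha>"
  using assms prime_cone_prime prime_cone_square by metis

lemma (in cring) mem_cone_supp_iff:
  assumes "prime_cone R \<alpha>"
  shows "a \<in> cone_supp R \<alpha> \<longleftrightarrow> a \<in> \<alpha> \<and> \<ominus> a \<in> \<alpha>"
  using prime_cone_subset[OF assms] minus_minus unfolding cone_supp_def
  by (force simp: image_iff)

lemma (in cring) cone_supp_ideal:
  assumes "prime_cone R \<alpha>"
  shows "ideal (cone_supp R \<alpha>) R"
proof -
  note sub = subsetD[OF prime_cone_subset[OF assms]]
  note add = prime_cone_add[OF assms] and mult = prime_cone_mult[OF assms]
  have absorb: "x \<otimes> a \<in> cone_supp R \<alpha>" if a: "a \<in> cone_supp R \<alpha>" and x: "x \<in> carrier R" for a x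
  proof -
    have a': "a \<in> \<alpha>" "\<ominus> a \<in> \<alpha>" "a \<in> carrier R"
      using a sub by (auto simp: mem_cone_supp_iff[OF assms])
    \<comment> \<open>Both signs of \<open>a\<close> lie in the cone, so the sign of \<open>x\<close> may be chosen freely.\<close>
    from prime_cone_total[OF assms x] show ?thesis
    proof
      assume "x \<in> \<alpha>"
      then show ?thesis
        using mult[of x a] mult[of x "\<ominus> a"] a' x by (simp add: mem_cone_supp_iff[OF assms] r_minus)
    next
      assume "\<ominus> x \<in> \<alpha>"
      then show ?thesis
        using mult[of "\<ominus> x" a] mult[of "\<ominus> x" "\<ominus> a"] a' x
        by (simp add: mem_cone_supp_iff[OF assms] r_minus l_minus)
    qed
  qed
  show ?thesis
  proof (rule idealI)
    show "ring R" by (rule ring_axioms)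
    show "subgroup (cone_supp R \<alpha>) (add_monoid R)"
    proof (rule add.subgroupI)
      show "cone_supp R \<alpha> \<subseteq> carrier R"
        using sub by (auto simp: mem_cone_supp_iff[OF assms])
      show "cone_supp R \<alpha> \<noteq> {}"
        using prime_cone_zero[OF assms] by (force simp: mem_cone_supp_iff[OF assms])
      show "\<ominus> a \<in> cone_supp R \<alpha>" if "a \<in> cone_supp R \<alpha>" for a
        using that sub by (auto simp: mem_cone_supp_iff[OF assms])
      show "a \<oplus> b \<in> cone_supp R \<alpha>" if "a \<in> cone_supp R \<alpha>" "b \<in> cone_supp R \<alpha>" for a b
        using that sub add by (auto simp: mem_cone_supp_iff[OF assms] minus_add)
    qed
    show "x \<otimes> a \<in> cone_supp R \<alpha>" if "a \<in> cone_supp R \<alpha>" "x \<in> carrier R" for a x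
      using absorb that .
    show "a \<otimes> x \<in> cone_supp R \<alpha>" if "a \<in> cone_supp R \<alpha>" "x \<in> carrier R" for a x
      using absorb[OF that] that sub by (metis m_comm mem_cone_supp_iff[OF assms])
  qed
qed

lemma (in cring) cone_supp_primeideal:
  assumes "prime_cone R \<alpha>"
  shows "primeideal (cone_supp R \<alpha>) R"
proof (intro primeidealI cone_supp_ideal[OF assms] is_cring)
  show "carrier R \<noteq> cone_supp R \<alpha>"
    using prime_cone_minus_one[OF assms] by (metis mem_cone_supp_iff[OF assms] one_closed)
  fix a b
  assume ab: "a \<in> carrier R" "b \<in> carrier R" "a \<otimes> b \<in> cone_supp R \<alpha>"
  then have p: "a \<otimes> b \<in> \<alpha>" "\<ominus> (a \<otimes> b) \<in> \<alpha>"
    by (auto simp: mem_cone_supp_iff[OF assms])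
  \<comment> \<open>Every choice of signs turns the product into a member of the cone, so the prime condition
    shows that a factor outside the support forces both signs of the other into the cone.\<close>
  have "a \<in> \<alpha> \<or> \<ominus> b \<in> \<alpha>"
    using prime_cone_prime[OF assms, of a b] ab p by simp
  moreover have "a \<in> \<alpha> \<or> b \<in> \<alpha>"
    using prime_cone_prime[OF assms, of a "\<ominus> b"] ab p by (simp add: r_minus)
  moreover have "\<ominus> a \<in> \<alpha> \<or> \<ominus> b \<in> \<alpha>"
    using prime_cone_prime[OF assms, of "\<ominus> a" b] ab p by (simp add: l_minus)
  moreover have "\<ominus> a \<in> \<alpha> \<or> b \<in> \<alpha>"
    using prime_cone_prime[OF assms, of "\<ominus> a" "\<ominus> b"] ab p by (simp add: l_minus r_minus)
  ultimately show "a \<in> cone_supp R \<alpha> \<or> b \<in> cone_supp R \<alpha>"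
    by (auto simp: mem_cone_supp_iff[OF assms])
qed

lemma (in cring) prime_cone_finsum:
  assumes "prime_cone R \<alpha>" "finite I" "g \<in> I \<rightarrow> \<alpha>"
  shows "(\<Oplus>i\<in>I. g i) \<in> \<alpha>"
  using assms(2,3)
proof (induction I rule: finite_induct)
  case empty
  then show ?case using prime_cone_zero[OF assms(1)] by simp
next
  case (insert i I)
  have "g \<in> I \<rightarrow> carrier R" "g i \<in> carrier R"
    using insert.prems prime_cone_subset[OF assms(1)] by auto
  then show ?case
    using insert prime_cone_add[OF assms(1)] by simp
qed

text \<open>
  If a sum of squares lies in the support, each square in it is both a member of the cone and the
  negative of one: its negative is the sum of the remaining squares minus the total. So the
  square lies in the support, and primeness passes this on to its root.
\<close>

lemma (in cring) cone_supp_real_prime_ideal: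
  assumes "prime_cone R \<alpha>"
  shows "real_prime_ideal R (cone_supp R \<alpha>)"
  unfolding real_prime_ideal_def
proof (intro conjI allI impI cone_supp_primeideal[OF assms])
  fix n :: nat and f i
  assume f: "f \<in> {..<n} \<rightarrow> carrier R"
    and sum: "(\<Oplus>j\<in>{..<n}. f j \<otimes> f j) \<in> cone_supp R \<alpha>" and i: "i < n"
  define s where "s = (\<Oplus>j\<in>{..<n} - {i}. f j \<otimes> f j)"
  have fi: "f i \<in> carrier R" using f i by auto
  have s: "s \<in> \<alpha>"
    unfolding s_def using f prime_cone_square[OF assms]
    by (intro prime_cone_finsum[OF assms]) auto
  then have sc: "s \<in> carrier R" using prime_cone_subset[OF assms] by blast
  have "(\<Oplus>j\<in>insert i ({..<n} - {i}). f j \<otimes> f j) = f i \<otimes> f i \<oplus> s"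
    unfolding s_def using f fi by (intro finsum_insert) auto
  then have "\<ominus> (f i \<otimes> f i \<oplus> s) \<in> \<alpha>"
    using sum i by (simp add: insert_absorb mem_cone_supp_iff[OF assms])
  then have "\<ominus> (f i \<otimes> f i \<oplus> s) \<oplus> s \<in> \<alpha>"
    using s prime_cone_add[OF assms] by blast
  moreover have "\<ominus> (f i \<otimes> f i \<oplus> s) \<oplus> s = \<ominus> (f i \<otimes> f i)"
    using fi sc by algebra
  ultimately have "f i \<otimes> f i \<in> cone_supp R \<alpha>"
    using prime_cone_square[OF assms fi] by (simp add: mem_cone_supp_iff[OF assms])
  then show "f i \<in> cone_supp R \<alpha>"
    using primeideal.I_prime[OF cone_supp_primeideal[OF assms] fi fi] by blast
qed

section \<open>Orderings and prime cones with zero support\<close>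

text \<open>
  This has the form of \<open>cone_less\<close> with the quotient ring and the image of the cone in it as
  parameters, so that an ordering of a quotient can be studied inside the quotient alone.
\<close>

definition order_of_cone :: "('a, 'm) ring_scheme \<Rightarrow> 'a set \<Rightarrow> ('a \<times> 'a) set" where
  "order_of_cone R \<alpha> = {(x, y) \<in> carrier R \<times> carrier R. x \<noteq> y \<and> y \<ominus>\<^bsub>R\<^esub> x \<in> \<alpha>}"

definition nonneg_cone :: "('a, 'm) ring_scheme \<Rightarrow> ('a \<times> 'a) set \<Rightarrow> 'a set" where
  "nonneg_cone R r = {x \<in> carrier R. x = \<zero>\<^bsub>R\<^esub> \<or> (\<zero>\<^bsub>R\<^esub>, x) \<in> r}"

text \<open>
  Zero support says that no nonzero element has both signs, which is what keeps a transitivity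
  chain \<open>x < y < z\<close> from closing up with \<open>x = z\<close>.
\<close>

lemma (in cring) order_of_cone_ordering:
  assumes \<alpha>: "prime_cone R \<alpha>" and supp: "cone_supp R \<alpha> = {\<zero>}"
  shows "ring_ordering R (order_of_cone R \<alpha>)"
proof -
  note add = prime_cone_add[OF \<alpha>] and mult = prime_cone_mult[OF \<alpha>]
  have antisym: "a = \<zero>" if "a \<in> \<alpha>" "\<ominus> a \<in> \<alpha>" for a
    using that supp mem_cone_supp_iff[OF \<alpha>] by blast
  have "\<one> \<noteq> \<zero>"
    using prime_cone_minus_one[OF \<alpha>] prime_cone_zero[OF \<alpha>] by auto
  moreover have "trans (order_of_cone R \<alpha>)"
  proof (rule transI)
    fix x y z
    assume xy: "(x, y) \<in> order_of_cone R \<alpha>" and yz: "(y, z) \<in> order_of_cone R \<alpha>"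
    then have c: "x \<in> carrier R" "y \<in> carrier R" "z \<in> carrier R"
      and d: "y \<ominus> x \<in> \<alpha>" "z \<ominus> y \<in> \<alpha>" "x \<noteq> y"
      unfolding order_of_cone_def by auto
    have "(z \<ominus> y) \<oplus> (y \<ominus> x) = z \<ominus> x" using c by algebra
    then have "z \<ominus> x \<in> \<alpha>" using add[OF d(2,1)] by simp
    moreover have "x \<noteq> z"
    proof
      assume "x = z"
      then have "\<ominus> (y \<ominus> x) = z \<ominus> y" using c by algebra
      then have "y \<ominus> x = \<zero>" using antisym d by metis
      then show False using c d(3) by (simp add: diff_eq_zero_iff)
    qed
    ultimately show "(x, z) \<in> order_of_cone R \<alpha>"
      using c by (simp add: order_of_cone_def)
  qed
  moreover have "irrefl (order_of_cone R \<alpha>)"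
    by (auto simp: irrefl_def order_of_cone_def)
  moreover have "total_on (carrier R) (order_of_cone R \<alpha>)"
  proof (rule total_onI)
    fix x y
    assume xy: "x \<in> carrier R" "y \<in> carrier R" "x \<noteq> y"
    have "\<ominus> (y \<ominus> x) = x \<ominus> y" using xy by algebra
    then show "(x, y) \<in> order_of_cone R \<alpha> \<or> (y, x) \<in> order_of_cone R \<alpha>"
      using prime_cone_total[OF \<alpha>, of "y \<ominus> x"] xy by (auto simp: order_of_cone_def)
  qed
  moreover have "(a \<oplus> c, b \<oplus> c) \<in> order_of_cone R \<alpha>"
    if "(a, b) \<in> order_of_cone R \<alpha>" "c \<in> carrier R" for a b c
  proof -
    have ab: "a \<in> carrier R" "b \<in> carrier R" "a \<noteq> b" "b \<ominus> a \<in> \<alpha>"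
      using that unfolding order_of_cone_def by auto
    have "(b \<oplus> c) \<ominus> (a \<oplus> c) = b \<ominus> a" using ab that(2) by algebra
    then show ?thesis using ab that(2) by (simp add: order_of_cone_def)
  qed
  moreover have "(\<zero>, a \<otimes> b) \<in> order_of_cone R \<alpha>"
    if "(\<zero>, a) \<in> order_of_cone R \<alpha>" "(\<zero>, b) \<in> order_of_cone R \<alpha>" for a b
  proof -
    have ab: "a \<in> carrier R" "b \<in> carrier R" "a \<noteq> \<zero>" "b \<noteq> \<zero>" "a \<in> \<alpha>" "b \<in> \<alpha>"
      using that unfolding order_of_cone_def by (auto simp: minus_eq)
    \<comment> \<open>The zero ideal is a support, hence prime: the product is not zero.\<close>
    have "a \<otimes> b \<noteq> \<zero>"
      using primeideal.I_prime[OF cone_supp_primeideal[OF \<alpha>], of a b] ab supp by auto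
    then show ?thesis using ab mult by (simp add: order_of_cone_def minus_eq)
  qed
  moreover have "order_of_cone R \<alpha> \<subseteq> carrier R \<times> carrier R"
    by (auto simp: order_of_cone_def)
  ultimately show ?thesis
    unfolding ring_ordering_def strict_linear_order_on_def by blast
qed

lemma ring_orderingD:
  assumes "ring_ordering R r"
  shows ordering_one_neq_zero: "\<one>\<^bsub>R\<^esub> \<noteq> \<zero>\<^bsub>R\<^esub>"
    and ordering_closed: "\<And>a b. (a, b) \<in> r \<Longrightarrow> a \<in> carrier R \<and> b \<in> carrier R"
    and ordering_trans: "\<And>a b c. \<lbrakk>(a, b) \<in> r; (b, c) \<in> r\<rbrakk> \<Longrightarrow> (a, c) \<in> r"
    and ordering_irrefl: "\<And>a. (a, a) \<notin> r"
    and ordering_total: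
      "\<And>a b. \<lbrakk>a \<in> carrier R; b \<in> carrier R; a \<noteq> b\<rbrakk> \<Longrightarrow> (a, b) \<in> r \<or> (b, a) \<in> r"
    and ordering_add: "\<And>a b c. \<lbrakk>(a, b) \<in> r; c \<in> carrier R\<rbrakk> \<Longrightarrow> (a \<oplus>\<^bsub>R\<^esub> c, b \<oplus>\<^bsub>R\<^esub> c) \<in> r"
    and ordering_mult:
      "\<And>a b. \<lbrakk>(\<zero>\<^bsub>R\<^esub>, a) \<in> r; (\<zero>\<^bsub>R\<^esub>, b) \<in> r\<rbrakk> \<Longrightarrow> (\<zero>\<^bsub>R\<^esub>, a \<otimes>\<^bsub>R\<^esub> b) \<in> r"
  using assms
  unfolding ring_ordering_def strict_linear_order_on_def
  by (auto dest: irreflD transD simp: total_on_def)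

lemma (in cring) ordering_less_iff:
  assumes r: "ring_ordering R r" and c: "a \<in> carrier R" "b \<in> carrier R"
  shows "(a, b) \<in> r \<longleftrightarrow> (\<zero>, b \<ominus> a) \<in> r"
proof
  assume "(a, b) \<in> r"
  from ordering_add[OF r this, of "\<ominus> a"] c show "(\<zero>, b \<ominus> a) \<in> r"
    by (simp add: minus_eq r_neg)
next
  assume "(\<zero>, b \<ominus> a) \<in> r"
  moreover have "b \<ominus> a \<oplus> a = b" using c by algebra
  ultimately show "(a, b) \<in> r"
    using ordering_add[OF r, of \<zero> "b \<ominus> a" a] c by simp
qed

lemma (in cring) nonneg_cone_antisym:
  assumes r: "ring_ordering R r" and a: "a \<in> nonneg_cone R r" "\<ominus> a \<in> nonneg_cone R r"
  shows "a = \<zero>"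
proof (rule ccontr)
  assume "a \<noteq> \<zero>"
  moreover have c: "a \<in> carrier R" using a by (simp add: nonneg_cone_def)
  ultimately have "(\<zero>, a) \<in> r" "(\<zero>, \<ominus> a) \<in> r"
    using a by (auto simp: nonneg_cone_def neg_eq_zero_iff)
  moreover have "(a, \<zero>) \<in> r"
    using \<open>(\<zero>, \<ominus> a) \<in> r\<close> c ordering_less_iff[OF r, of a \<zero>] by (simp add: minus_eq)
  ultimately show False
    using ordering_trans[OF r] ordering_irrefl[OF r] by blast
qed

lemma (in cring) nonneg_cone_total:
  assumes r: "ring_ordering R r" and c: "a \<in> carrier R"
  shows "a \<in> nonneg_cone R r \<or> \<ominus> a \<in> nonneg_cone R r"
  using ordering_total[OF r, of \<zero> a] ordering_less_iff[OF r, of a \<zero>] c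
  by (auto simp: nonneg_cone_def minus_eq)

lemma (in cring) nonneg_cone_prime_cone:
  assumes r: "ring_ordering R r"
  shows "prime_cone R (nonneg_cone R r)" (is "prime_cone R ?P")
proof -
  have sub: "?P \<subseteq> carrier R" by (auto simp: nonneg_cone_def)
  have add: "a \<oplus> b \<in> ?P" if "a \<in> ?P" "b \<in> ?P" for a b
  proof (cases "a = \<zero> \<or> b = \<zero>")
    case True
    then show ?thesis using that by (auto simp: nonneg_cone_def)
  next
    case False
    then have ab: "(\<zero>, a) \<in> r" "(\<zero>, b) \<in> r" "a \<in> carrier R" "b \<in> carrier R"
      using that by (auto simp: nonneg_cone_def)
    then have "(b, a \<oplus> b) \<in> r" using ordering_add[OF r ab(1,4)] by simp
    then have "(\<zero>, a \<oplus> b) \<in> r" using ordering_trans[OF r ab(2)] by blast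
    then show ?thesis using ab by (simp add: nonneg_cone_def)
  qed
  have mult: "a \<otimes> b \<in> ?P" if "a \<in> ?P" "b \<in> ?P" for a b
    using that ordering_mult[OF r, of a b] by (auto simp: nonneg_cone_def)
  have square: "a \<otimes> a \<in> ?P" if c: "a \<in> carrier R" for a
    using nonneg_cone_total[OF r c] mult[of a a] mult[of "\<ominus> a" "\<ominus> a"] c
    by (auto simp: l_minus r_minus)
  have "\<ominus> \<one> \<notin> ?P"
    using nonneg_cone_antisym[OF r, of \<one>] square[of \<one>] ordering_one_neq_zero[OF r] by fastforce
  moreover have "a \<in> ?P \<or> \<ominus> b \<in> ?P"
    if c: "a \<in> carrier R" "b \<in> carrier R" and ab: "a \<otimes> b \<in> ?P" for a b
  proof (rule ccontr)
    assume neg: "\<not> (a \<in> ?P \<or> \<ominus> b \<in> ?P)"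
    have zero: "\<zero> \<in> ?P" by (simp add: nonneg_cone_def)
    have "\<ominus> a \<in> ?P" "b \<in> ?P"
      using neg nonneg_cone_total[OF r c(1)] nonneg_cone_total[OF r c(2)] by auto
    moreover have "\<ominus> a \<noteq> \<zero>" "b \<noteq> \<zero>"
      using neg zero c neg_eq_zero_iff[of a] by auto
    ultimately have pos: "(\<zero>, \<ominus> a \<otimes> b) \<in> r"
      using ordering_mult[OF r, of "\<ominus> a" b] by (simp add: nonneg_cone_def)
    \<comment> \<open>A negative \<open>a\<close> and a positive \<open>b\<close> have a negative product, which cannot lie in the cone.\<close>
    then have "\<ominus> (a \<otimes> b) \<in> ?P"
      using c by (simp add: nonneg_cone_def l_minus)
    then have "a \<otimes> b = \<zero>" using nonneg_cone_antisym[OF r ab] by simp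
    then show False using pos c ordering_irrefl[OF r] by (simp add: l_minus)
  qed
  ultimately show ?thesis
    using sub add mult square by (simp add: prime_cone_def)
qed

lemma (in cring) cone_supp_nonneg_cone:
  assumes r: "ring_ordering R r"
  shows "cone_supp R (nonneg_cone R r) = {\<zero>}"
  using prime_cone_zero[OF nonneg_cone_prime_cone[OF r]]
  by (auto simp: mem_cone_supp_iff[OF nonneg_cone_prime_cone[OF r]]
      intro: nonneg_cone_antisym[OF r])

lemma (in cring) nonneg_cone_order_of_cone:
  assumes \<alpha>: "prime_cone R \<alpha>"
  shows "nonneg_cone R (order_of_cone R \<alpha>) = \<alpha>"
  using prime_cone_zero[OF \<alpha>] prime_cone_subset[OF \<alpha>]
  by (auto simp: nonneg_cone_def order_of_cone_def minus_eq)

lemma (in cring) order_of_cone_nonneg_cone: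
  assumes r: "ring_ordering R r"
  shows "order_of_cone R (nonneg_cone R r) = r"
proof -
  have "(x, y) \<in> order_of_cone R (nonneg_cone R r) \<longleftrightarrow> (x, y) \<in> r" for x y
  proof (cases "x \<in> carrier R \<and> y \<in> carrier R")
    case True
    then show ?thesis
      using ordering_less_iff[OF r, of x y] ordering_irrefl[OF r, of x]
      by (auto simp: nonneg_cone_def order_of_cone_def diff_eq_zero_iff)
  next
    case False
    then show ?thesis
      using ordering_closed[OF r, of x y] by (auto simp: order_of_cone_def)
  qed
  then show ?thesis by auto
qed

text \<open>
  By totality, absence of elements strictly between \<open>0\<close> and \<open>1\<close> means that every positive \<open>f\<close>
  satisfies \<open>f \<ge> 1\<close>, which is the condition on the cone.
\<close>

lemma (in cring) discrete_order_of_cone_iff: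
  assumes \<alpha>: "prime_cone R \<alpha>" and supp: "cone_supp R \<alpha> = {\<zero>}"
  shows "discrete_ordering R (order_of_cone R \<alpha>) \<longleftrightarrow> discrete_prime_cone R \<alpha>"
proof
  assume d: "discrete_prime_cone R \<alpha>"
  have False if a: "(\<zero>, a) \<in> order_of_cone R \<alpha>" "(a, \<one>) \<in> order_of_cone R \<alpha>" for a
  proof -
    have a': "a \<in> carrier R" "a \<noteq> \<zero>" "a \<in> \<alpha>" "a \<noteq> \<one>" "\<one> \<ominus> a \<in> \<alpha>"
      using a by (auto simp: order_of_cone_def minus_eq)
    have "a \<ominus> \<one> \<in> \<alpha>"
      using d a' supp unfolding discrete_prime_cone_def by auto
    moreover have "\<ominus> (a \<ominus> \<one>) = \<one> \<ominus> a" using a' by algebra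
    ultimately have "a \<ominus> \<one> = \<zero>"
      using a' mem_cone_supp_iff[OF \<alpha>, of "a \<ominus> \<one>"] supp by auto
    then show False using a' by (simp add: diff_eq_zero_iff)
  qed
  then show "discrete_ordering R (order_of_cone R \<alpha>)"
    using order_of_cone_ordering[OF \<alpha> supp] unfolding discrete_ordering_def by blast
next
  assume d: "discrete_ordering R (order_of_cone R \<alpha>)"
  have "f \<ominus> \<one> \<in> \<alpha>" if f: "f \<in> carrier R" "f \<in> \<alpha>" "f \<noteq> \<zero>" for f
  proof (cases "f = \<one>")
    case True
    then show ?thesis using prime_cone_zero[OF \<alpha>] by (simp add: minus_eq r_neg)
  next
    case False
    have "(\<zero>, f) \<in> order_of_cone R \<alpha>"
      using f by (auto simp: order_of_cone_def minus_eq)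
    then have "(f, \<one>) \<notin> order_of_cone R \<alpha>"
      using d f(1) unfolding discrete_ordering_def by blast
    then have "(\<one>, f) \<in> order_of_cone R \<alpha>"
      using ordering_total[OF order_of_cone_ordering[OF \<alpha> supp]] f(1) False by blast
    then show ?thesis by (simp add: order_of_cone_def)
  qed
  then show "discrete_prime_cone R \<alpha>"
    using \<alpha> supp unfolding discrete_prime_cone_def real_spectrum_def by simp
qed

lemma discrete_prime_cone_prime_cone: "discrete_prime_cone R \<alpha> \<Longrightarrow> prime_cone R \<alpha>"
  by (simp add: discrete_prime_cone_def real_spectrum_def)

theorem (in cring) bij_betw_order_of_cone:
  "bij_betw (order_of_cone R)
     {\<alpha>. discrete_prime_cone R \<alpha> \<and> cone_supp R \<alpha> = {\<zero>}} {r. discrete_ordering R r}"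
proof (rule bij_betw_byWitness[where f' = "nonneg_cone R"])
  show "\<forall>\<alpha>\<in>{\<alpha>. discrete_prime_cone R \<alpha> \<and> cone_supp R \<alpha> = {\<zero>}}.
      nonneg_cone R (order_of_cone R \<alpha>) = \<alpha>"
    by (simp add: nonneg_cone_order_of_cone discrete_prime_cone_prime_cone)
  show "\<forall>r\<in>{r. discrete_ordering R r}. order_of_cone R (nonneg_cone R r) = r"
    by (simp add: order_of_cone_nonneg_cone discrete_ordering_def)
  show "order_of_cone R ` {\<alpha>. discrete_prime_cone R \<alpha> \<and> cone_supp R \<alpha> = {\<zero>}}
      \<subseteq> {r. discrete_ordering R r}"
    by (auto simp: discrete_order_of_cone_iff discrete_prime_cone_prime_cone)
  show "nonneg_cone R ` {r. discrete_ordering R r}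
      \<subseteq> {\<alpha>. discrete_prime_cone R \<alpha> \<and> cone_supp R \<alpha> = {\<zero>}}"
  proof clarify
    fix r assume d: "discrete_ordering R r"
    then have r: "ring_ordering R r" by (simp add: discrete_ordering_def)
    show "discrete_prime_cone R (nonneg_cone R r) \<and> cone_supp R (nonneg_cone R r) = {\<zero>}"
      using discrete_order_of_cone_iff[OF nonneg_cone_prime_cone[OF r] cone_supp_nonneg_cone[OF r]]
        cone_supp_nonneg_cone[OF r] order_of_cone_nonneg_cone[OF r] d by simp
  qed
qed

section \<open>Prime cones along surjective homomorphisms\<close>

context ring_hom_cring
begin

lemma hom_minus:
  assumes "a \<in> carrier R" "b \<in> carrier R"
  shows "h (a \<ominus> b) = h a \<ominus>\<^bsub>S\<^esub> h b"
  using assms by (simp add: R.minus_eq S.minus_eq)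

lemma hom_eq_iff_diff_in_kernel:
  assumes "a \<in> carrier R" "b \<in> carrier R"
  shows "h a = h b \<longleftrightarrow> h (a \<ominus> b) = \<zero>\<^bsub>S\<^esub>"
  using assms by (simp add: hom_minus S.diff_eq_zero_iff)

text \<open>
  A cone is stable under translation by its support, so it is saturated for a homomorphism whose
  kernel is that support. This is what makes taking images harmless.
\<close>

lemma hom_mem_image_cone_iff:
  assumes \<alpha>: "prime_cone R \<alpha>" and supp: "cone_supp R \<alpha> = {x \<in> carrier R. h x = \<zero>\<^bsub>S\<^esub>}"
    and a: "a \<in> carrier R"
  shows "h a \<in> h ` \<alpha> \<longleftrightarrow> a \<in> \<alpha>"
proof
  assume "h a \<in> h ` \<alpha>"
  then obtain b where b: "b \<in> \<alpha>" "h a = h b" by blast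
  then have bc: "b \<in> carrier R" using prime_cone_subset[OF \<alpha>] by blast
  have "a \<ominus> b \<in> cone_supp R \<alpha>"
    using supp a bc b(2) hom_eq_iff_diff_in_kernel[OF a bc] by simp
  then have "(a \<ominus> b) \<oplus> b \<in> \<alpha>"
    using b(1) prime_cone_add[OF \<alpha>] by (auto simp: R.mem_cone_supp_iff[OF \<alpha>])
  moreover have "(a \<ominus> b) \<oplus> b = a" using a bc by algebra
  ultimately show "a \<in> \<alpha>" by simp
qed blast

text \<open>
  Since \<open>h\<close> is onto and detects membership in the cone, every clause in the definition of a
  (discrete) prime cone can be read on either side of \<open>h\<close>.
\<close>

lemma prime_cone_transfer:
  assumes onto: "h ` carrier R = carrier S"
    and \<alpha>: "\<alpha> \<subseteq> carrier R" and \<beta>: "\<beta> \<subseteq> carrier S"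
    and mem: "\<And>a. a \<in> carrier R \<Longrightarrow> h a \<in> \<beta> \<longleftrightarrow> a \<in> \<alpha>"
  shows "prime_cone R \<alpha> \<longleftrightarrow> prime_cone S \<beta>"
proof -
  have all_S: "(\<forall>x\<in>carrier S. P x) \<longleftrightarrow> (\<forall>a\<in>carrier R. P (h a))" for P
    using onto by force
  have all_\<alpha>: "(\<forall>a\<in>\<alpha>. P a) \<longleftrightarrow> (\<forall>a\<in>carrier R. a \<in> \<alpha> \<longrightarrow> P a)" for P
    using \<alpha> by blast
  have all_\<beta>: "(\<forall>x\<in>\<beta>. P x) \<longleftrightarrow> (\<forall>x\<in>carrier S. x \<in> \<beta> \<longrightarrow> P x)" for P
    using \<beta> by blast
  have pull: "h a \<oplus>\<^bsub>S\<^esub> h b \<in> \<beta> \<longleftrightarrow> a \<oplus> b \<in> \<alpha>" "h a \<otimes>\<^bsub>S\<^esub> h b \<in> \<beta> \<longleftrightarrow> a \<otimes> b \<in> \<alpha>"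
    "\<ominus>\<^bsub>S\<^esub> h a \<in> \<beta> \<longleftrightarrow> \<ominus> a \<in> \<alpha>"
    if "a \<in> carrier R" "b \<in> carrier R" for a b
    using that mem[of "a \<oplus> b"] mem[of "a \<otimes> b"] mem[of "\<ominus> a"] by simp_all
  have "\<ominus>\<^bsub>S\<^esub> \<one>\<^bsub>S\<^esub> \<in> \<beta> \<longleftrightarrow> \<ominus> \<one> \<in> \<alpha>"
    using pull(3)[of \<one> \<one>] by simp
  then show ?thesis
    unfolding prime_cone_def all_\<alpha> all_\<beta> all_S
    using \<alpha> \<beta> by (simp add: mem pull cong: ball_cong)
qed

lemma cone_supp_transfer:
  assumes \<alpha>: "prime_cone R \<alpha>" and \<beta>: "prime_cone S \<beta>"
    and mem: "\<And>a. a \<in> carrier R \<Longrightarrow> h a \<in> \<beta> \<longleftrightarrow> a \<in> \<alpha>" and a: "a \<in> carrier R"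
  shows "h a \<in> cone_supp S \<beta> \<longleftrightarrow> a \<in> cone_supp R \<alpha>"
  using mem[OF a] mem[of "\<ominus> a"] a
  by (simp add: R.mem_cone_supp_iff[OF \<alpha>] S.mem_cone_supp_iff[OF \<beta>])

lemma discrete_prime_cone_transfer:
  assumes onto: "h ` carrier R = carrier S"
    and \<alpha>: "\<alpha> \<subseteq> carrier R" and \<beta>: "\<beta> \<subseteq> carrier S"
    and mem: "\<And>a. a \<in> carrier R \<Longrightarrow> h a \<in> \<beta> \<longleftrightarrow> a \<in> \<alpha>"
  shows "discrete_prime_cone R \<alpha> \<longleftrightarrow> discrete_prime_cone S \<beta>"
proof (cases "prime_cone R \<alpha>")
  case True
  then have cones: "prime_cone R \<alpha>" "prime_cone S \<beta>"
    using prime_cone_transfer[OF onto \<alpha> \<beta> mem] by auto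
  have all_S: "(\<forall>x\<in>carrier S. P x) \<longleftrightarrow> (\<forall>a\<in>carrier R. P (h a))" for P
    using onto by force
  have "h f \<ominus>\<^bsub>S\<^esub> \<one>\<^bsub>S\<^esub> \<in> \<beta> \<longleftrightarrow> f \<ominus> \<one> \<in> \<alpha>" if "f \<in> carrier R" for f
    using that mem[of "f \<ominus> \<one>"] by (simp add: hom_minus)
  then show ?thesis
    unfolding discrete_prime_cone_def real_spectrum_def all_S
    using cones by (simp add: mem cone_supp_transfer[OF cones mem] cong: ball_cong)
next
  case False
  then have "\<not> prime_cone S \<beta>"
    using prime_cone_transfer[OF onto \<alpha> \<beta> mem] by auto
  then show ?thesis
    using False by (auto dest: discrete_prime_cone_prime_cone)
qed

theorem bij_betw_image_cone:
  assumes onto: "h ` carrier R = carrier S"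
  shows "bij_betw ((`) h)
    {\<alpha>. discrete_prime_cone R \<alpha> \<and> cone_supp R \<alpha> = {x \<in> carrier R. h x = \<zero>\<^bsub>S\<^esub>}}
    {\<beta>. discrete_prime_cone S \<beta> \<and> cone_supp S \<beta> = {\<zero>\<^bsub>S\<^esub>}}"
    (is "bij_betw _ ?C ?D")
proof (rule bij_betw_byWitness[where f' = "\<lambda>\<beta>. {a \<in> carrier R. h a \<in> \<beta>}"])
  have C: "prime_cone R \<alpha>" "\<And>a. a \<in> carrier R \<Longrightarrow> h a \<in> h ` \<alpha> \<longleftrightarrow> a \<in> \<alpha>" if "\<alpha> \<in> ?C" for \<alpha>
    using that hom_mem_image_cone_iff discrete_prime_cone_prime_cone by blast+
  show "\<forall>\<alpha>\<in>?C. {a \<in> carrier R. h a \<in> h ` \<alpha>} = \<alpha>"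
    using C prime_cone_subset by blast
  show "\<forall>\<beta>\<in>?D. h ` {a \<in> carrier R. h a \<in> \<beta>} = \<beta>"
  proof
    fix \<beta> assume "\<beta> \<in> ?D"
    then have "\<beta> \<subseteq> h ` carrier R"
      using onto prime_cone_subset discrete_prime_cone_prime_cone by blast
    then show "h ` {a \<in> carrier R. h a \<in> \<beta>} = \<beta>" by blast
  qed
  show "(`) h ` ?C \<subseteq> ?D"
  proof (rule image_subsetI)
    fix \<alpha> assume \<alpha>: "\<alpha> \<in> ?C"
    have sub: "\<alpha> \<subseteq> carrier R" "h ` \<alpha> \<subseteq> carrier S"
      using prime_cone_subset[OF C(1)[OF \<alpha>]] by auto
    have d: "discrete_prime_cone S (h ` \<alpha>)"
      using discrete_prime_cone_transfer[OF onto sub C(2)[OF \<alpha>]] \<alpha> by blast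
    have cone: "prime_cone S (h ` \<alpha>)" using d by (rule discrete_prime_cone_prime_cone)
    have "x \<in> cone_supp S (h ` \<alpha>) \<longleftrightarrow> x = \<zero>\<^bsub>S\<^esub>" if x: "x \<in> carrier S" for x
    proof -
      obtain a where a: "a \<in> carrier R" "x = h a" using onto x by blast
      then show ?thesis
        using cone_supp_transfer[OF C(1)[OF \<alpha>] cone C(2)[OF \<alpha>] a(1)] \<alpha> by simp
    qed
    moreover have "cone_supp S (h ` \<alpha>) \<subseteq> carrier S"
      using sub(2) by (auto simp: cone_supp_def)
    ultimately show "h ` \<alpha> \<in> ?D" using d by blast
  qed
  show "(\<lambda>\<beta>. {a \<in> carrier R. h a \<in> \<beta>}) ` ?D \<subseteq> ?C"
  proof (rule image_subsetI)
    fix \<beta> assume \<beta>: "\<beta> \<in> ?D"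
    let ?\<alpha> = "{a \<in> carrier R. h a \<in> \<beta>}"
    have cone: "prime_cone S \<beta>" using \<beta> discrete_prime_cone_prime_cone by blast
    have mem: "h a \<in> \<beta> \<longleftrightarrow> a \<in> ?\<alpha>" if "a \<in> carrier R" for a using that by blast
    have sub: "?\<alpha> \<subseteq> carrier R" by blast
    have d: "discrete_prime_cone R ?\<alpha>"
      using discrete_prime_cone_transfer[OF onto sub prime_cone_subset[OF cone] mem] \<beta> by blast
    have "a \<in> cone_supp R ?\<alpha> \<longleftrightarrow> h a = \<zero>\<^bsub>S\<^esub>" if "a \<in> carrier R" for a
      using cone_supp_transfer[OF discrete_prime_cone_prime_cone[OF d] cone mem that] \<beta> by simp
    moreover have "cone_supp R ?\<alpha> \<subseteq> carrier R"
      by (auto simp: cone_supp_def)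
    ultimately show "?\<alpha> \<in> ?C" using d by blast
  qed
qed

end

section \<open>The correspondence\<close>

context cring
begin

lemma coset_eq_zero_iff:
  assumes "ideal p R" "x \<in> carrier R"
  shows "p +> x = \<zero>\<^bsub>R Quot p\<^esub> \<longleftrightarrow> x \<in> p"
proof -
  interpret p: ideal p R by fact
  show ?thesis
    using p.rcos_const_imp_mem[OF assms(2)] p.a_rcos_const by (auto simp: FactRing_def)
qed

lemma carrier_quotient: "(+>) p ` carrier R = carrier (R Quot p)"
  unfolding FactRing_def A_RCOSETS_def' by auto

lemma kernel_quotient:
  assumes "ideal p R"
  shows "{x \<in> carrier R. p +> x = \<zero>\<^bsub>R Quot p\<^esub>} = p"
proof -
  have "{x \<in> carrier R. p +> x = \<zero>\<^bsub>R Quot p\<^esub>} = {x \<in> carrier R. x \<in> p}"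
    by (rule Collect_cong) (simp add: coset_eq_zero_iff[OF assms] cong: conj_cong)
  also have "\<dots> = p"
    using ideal.Icarr[OF assms] by blast
  finally show ?thesis .
qed

lemma cone_less_eq_order_of_cone:
  "cone_less R \<alpha> = order_of_cone (R Quot cone_supp R \<alpha>) ((+>) (cone_supp R \<alpha>) ` \<alpha>)"
  by (simp add: cone_less_def order_of_cone_def Let_def)

text \<open>
  The fibre of the correspondence over an ideal \<open>p\<close>. Fixing the support also fixes the
  quotient ring in which the orders \<open>cone_less R \<alpha>\<close> live, so that they can be compared.
\<close>

lemma bij_betw_cone_less:
  assumes p: "ideal p R"
  shows "bij_betw (cone_less R) {\<alpha>. discrete_prime_cone R \<alpha> \<and> cone_supp R \<alpha> = p}
    {r. discrete_ordering (R Quot p) r}"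
proof -
  interpret p: ideal p R by (rule p)
  interpret h: ring_hom_cring R "R Quot p" "(+>) p"
    by (rule p.rcos_ring_hom_cring[OF is_cring])
  have onto: "(+>) p ` carrier R = carrier (R Quot p)"
    by (rule carrier_quotient)
  have kernel: "{x \<in> carrier R. p +> x = \<zero>\<^bsub>R Quot p\<^esub>} = p"
    by (rule kernel_quotient[OF p])
  have bij: "bij_betw (order_of_cone (R Quot p) \<circ> (`) ((+>) p))
      {\<alpha>. discrete_prime_cone R \<alpha> \<and> cone_supp R \<alpha> = p} {r. discrete_ordering (R Quot p) r}"
    by (rule bij_betw_trans[OF h.bij_betw_image_cone[OF onto, unfolded kernel]
          h.S.bij_betw_order_of_cone])
  have eq: "(order_of_cone (R Quot p) \<circ> (`) ((+>) p)) \<alpha> = cone_less R \<alpha>"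
    if "\<alpha> \<in> {\<alpha>. discrete_prime_cone R \<alpha> \<and> cone_supp R \<alpha> = p}" for \<alpha>
    using that cone_less_eq_order_of_cone[of \<alpha>] by simp
  show ?thesis
    by (rule iffD1[OF bij_betw_cong[OF eq] bij])
qed

text \<open>
  For zero support the projection to the quotient is injective, so nothing is lost by comparing
  elements of the ring through their cosets.
\<close>

lemma cone_less_pullback_eq_order_of_cone:
  assumes \<alpha>: "prime_cone R \<alpha>" and supp: "cone_supp R \<alpha> = {\<zero>}"
  shows "cone_less_pullback R \<alpha> = order_of_cone R \<alpha>"
proof -
  let ?p = "cone_supp R \<alpha>"
  interpret p: ideal ?p R by (rule cone_supp_ideal[OF \<alpha>])
  interpret h: ring_hom_cring R "R Quot ?p" "(+>) ?p"
    by (rule p.rcos_ring_hom_cring[OF is_cring])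
  note zero_iff = coset_eq_zero_iff[OF p.is_ideal]
  have kernel: "?p = {x \<in> carrier R. ?p +> x = \<zero>\<^bsub>R Quot ?p\<^esub>}"
    by (rule kernel_quotient[OF p.is_ideal, symmetric])
  have "(?p +> a, ?p +> b) \<in> cone_less R \<alpha> \<longleftrightarrow> a \<noteq> b \<and> b \<ominus> a \<in> \<alpha>"
    if c: "a \<in> carrier R" "b \<in> carrier R" for a b
  proof -
    have "?p +> a = ?p +> b \<longleftrightarrow> a = b"
      using h.hom_eq_iff_diff_in_kernel[OF c] zero_iff[of "a \<ominus> b"] c supp
      by (simp add: diff_eq_zero_iff)
    moreover have "(?p +> b) \<ominus>\<^bsub>R Quot ?p\<^esub> (?p +> a) \<in> (+>) ?p ` \<alpha> \<longleftrightarrow> b \<ominus> a \<in> \<alpha>"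
      using h.hom_mem_image_cone_iff[OF \<alpha> kernel, of "b \<ominus> a"] c by (simp add: h.hom_minus)
    ultimately show ?thesis
      using c by (simp add: cone_less_eq_order_of_cone order_of_cone_def)
  qed
  then show ?thesis
    by (auto simp: cone_less_pullback_def order_of_cone_def)
qed

end

theorem corollary3p4:
  fixes A :: "('a, 'm) ring_scheme"
  assumes "cring A"
  shows "bij_betw (\<lambda>\<alpha>. (cone_supp A \<alpha>, cone_less A \<alpha>))
           {\<alpha>. discrete_prime_cone A \<alpha>}
           {(p, r). real_prime_ideal A p \<and> discrete_ordering (A Quot p) r} \<and>
         bij_betw (cone_less_pullback A)
           {\<alpha>. discrete_prime_cone A \<alpha> \<and> cone_supp A \<alpha> = {\<zero>\<^bsub>A\<^esub>}}
           {r. discrete_ordering A r}"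
proof
  interpret A: cring A by fact
  let ?F = "\<lambda>\<alpha>. (cone_supp A \<alpha>, cone_less A \<alpha>)"
  let ?fibre = "\<lambda>p. {\<alpha>. discrete_prime_cone A \<alpha> \<and> cone_supp A \<alpha> = p}"
  have real: "real_prime_ideal A (cone_supp A \<alpha>)" if "discrete_prime_cone A \<alpha>" for \<alpha>
    using A.cone_supp_real_prime_ideal[OF discrete_prime_cone_prime_cone[OF that]] .
  have bij: "bij_betw (cone_less A) (?fibre p) {r. discrete_ordering (A Quot p) r}"
    if "real_prime_ideal A p" for p
    using A.bij_betw_cone_less that primeideal.axioms(1) unfolding real_prime_ideal_def by blast
  show "bij_betw ?F {\<alpha>. discrete_prime_cone A \<alpha>}
      {(p, r). real_prime_ideal A p \<and> discrete_ordering (A Quot p) r}"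
    unfolding bij_betw_def
  proof
    show "inj_on ?F {\<alpha>. discrete_prime_cone A \<alpha>}"
    proof (rule inj_onI)
      fix \<alpha> \<beta>
      assume "\<alpha> \<in> {\<alpha>. discrete_prime_cone A \<alpha>}" "\<beta> \<in> {\<alpha>. discrete_prime_cone A \<alpha>}" "?F \<alpha> = ?F \<beta>"
      then show "\<alpha> = \<beta>"
        using inj_onD[OF bij_betw_imp_inj_on[OF bij[OF real[of \<alpha>]]], of \<alpha> \<beta>] by simp
    qed
    show "?F ` {\<alpha>. discrete_prime_cone A \<alpha>}
        = {(p, r). real_prime_ideal A p \<and> discrete_ordering (A Quot p) r}"
    proof (intro subset_antisym subsetI)
      fix pr assume "pr \<in> ?F ` {\<alpha>. discrete_prime_cone A \<alpha>}"
      then obtain \<alpha> where \<alpha>: "discrete_prime_cone A \<alpha>" "pr = ?F \<alpha>" by blast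
      then show "pr \<in> {(p, r). real_prime_ideal A p \<and> discrete_ordering (A Quot p) r}"
        using real[OF \<alpha>(1)] bij_betw_apply[OF bij[OF real[OF \<alpha>(1)]], of \<alpha>] by simp
    next
      fix pr assume "pr \<in> {(p, r). real_prime_ideal A p \<and> discrete_ordering (A Quot p) r}"
      then obtain p r where pr: "pr = (p, r)" "real_prime_ideal A p" "discrete_ordering (A Quot p) r"
        by blast
      then obtain \<alpha> where "\<alpha> \<in> ?fibre p" "r = cone_less A \<alpha>"
        using bij_betw_imp_surj_on[OF bij[OF pr(2)]] by blast
      then show "pr \<in> ?F ` {\<alpha>. discrete_prime_cone A \<alpha>}"
        using pr(1) by blast
    qed
  qed
  show "bij_betw (cone_less_pullback A)
      {\<alpha>. discrete_prime_cone A \<alpha> \<and> cone_supp A \<alpha> = {\<zero>\<^bsub>A\<^esub>}} {r. discrete_ordering A r}"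
    using A.bij_betw_order_of_cone
    by (rule bij_betw_cong[THEN iffD1, rotated])
      (auto simp: A.cone_less_pullback_eq_order_of_cone discrete_prime_cone_prime_cone)
qed

end
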